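(* For all integers $n\ge 4$, $\gamma_2(n)=2n$.
   Context: $\mathbb{N}$ denotes the positive integers. For a finite set $A$, $O_A$ is the set of all finitary operations $A^m\to A$ ($m\in\mathbb{N}$); for $F\subseteq O_A$, $F^{(m)}$ is the set of $m$-ary operations in $F$. A set $F\subseteq O_A$ is a clone on $A$ if it contains all projections and is closed under composition: for $f\in F^{(m)}$ and $g_1,\dots,g_m\in F^{(m')}$, the operation $f(g_1,\dots,g_m)(x_1,\dots,x_{m'}) := f(g_1(x_1,\dots,x_{m'}),\dots,g_m(x_1,\dots,x_{m'}))$ is in $F$. $\mathrm{Clo}(F)$ is the smallest clone containing $F$. For $d\ge 2$, an operation $g\colon A^{d+1}\to A$ is a near-unanimity operation if for all $x,y\in A$: $g(x,\dots,x,y)=g(x,\dots,x,y,x)=\dots=g(y,x,\dots,x)=x$. It is conservative if $g(x_1,\dots,x_{d+1})\in\{x_1,\dots,x_{d+1}\}$ for all $x_1,\dots,x_{d+1}\in A$. For a clone $C$ on a finite set containing a near-unanimity operation, $\lambda(C):=\min\{m\in\mathbb{N}\mid C=\mathrm{Clo}(C^{(m)})\}$ (this exists by the Baker–Pixley theorem). For $d\ge2$, $n\ge 2$, let $\mathcal{C}^d_n$ be the set of all clones on $\{0,\dots,n-1\}$ that contain a $(d+1)$-ary conservative near-unanimity operation (a finite set, as a consequence of the Baker–Pixley theorem), and $\gamma_d(n):=\max\{\lambda(C)\mid C\in\mathcal{C}^d_n\}$. Thus $\gamma_2(n)$ concerns clones containing a ternary conservative near-unanimity operation. *)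

theory Defs
  imports Main "HOL-Library.FuncSet"
begin

definition tuples :: "'a set \<Rightarrow> nat \<Rightarrow> 'a list set" where
  "tuples A m = {xs. length xs = m \<and> set xs \<subseteq> A}"

text \<open>
  An operation is a pair of its arity and its graph as a function on lists. The function is
  extensional (undefined off the tuples of the right length over the carrier), so that
  equality of operations is equality of their arities and of their values on the carrier.
\<close>

type_synonym 'a operation = "nat \<times> ('a list \<Rightarrow> 'a)"

definition all_ops :: "'a set \<Rightarrow> 'a operation set" where
  "all_ops A = {(m, f). 1 \<le> m \<and> f \<in> tuples A m \<rightarrow>\<^sub>E A}"

definition ary_part :: "'a operation set \<Rightarrow> nat \<Rightarrow> 'a operation set" where
  "ary_part F m = {p \<in> F. fst p = m}"

text \<open>Coordinates are numbered from 0.\<close>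

definition proj_op :: "'a set \<Rightarrow> nat \<Rightarrow> nat \<Rightarrow> 'a operation" where
  "proj_op A m i = (m, restrict (\<lambda>xs. xs ! i) (tuples A m))"

definition comp_op ::
    "'a set \<Rightarrow> nat \<Rightarrow> ('a list \<Rightarrow> 'a) \<Rightarrow> ('a list \<Rightarrow> 'a) list \<Rightarrow> 'a operation" where
  "comp_op A k f gs = (k, restrict (\<lambda>xs. f (map (\<lambda>g. g xs) gs)) (tuples A k))"

definition is_clone :: "'a set \<Rightarrow> 'a operation set \<Rightarrow> bool" where
  "is_clone A F \<longleftrightarrow>
     F \<subseteq> all_ops A \<and>
     (\<forall>m i. i < m \<longrightarrow> proj_op A m i \<in> F) \<and>
     (\<forall>m k f gs. (m, f) \<in> F \<and> length gs = m \<and> (\<forall>g \<in> set gs. (k, g) \<in> F)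
        \<longrightarrow> comp_op A k f gs \<in> F)"

definition Clo :: "'a set \<Rightarrow> 'a operation set \<Rightarrow> 'a operation set" where
  "Clo A F = \<Inter> {C. is_clone A C \<and> F \<subseteq> C}"

definition near_unanimity :: "'a set \<Rightarrow> nat \<Rightarrow> ('a list \<Rightarrow> 'a) \<Rightarrow> bool" where
  "near_unanimity A d g \<longleftrightarrow>
     (d + 1, g) \<in> all_ops A \<and>
     (\<forall>x\<in>A. \<forall>y\<in>A. \<forall>i < d + 1. g ((replicate (d + 1) x)[i := y]) = x)"

definition conservative :: "'a set \<Rightarrow> nat \<Rightarrow> ('a list \<Rightarrow> 'a) \<Rightarrow> bool" where
  "conservative A m g \<longleftrightarrow> (\<forall>xs \<in> tuples A m. g xs \<in> set xs)"

text \<open>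
  The minimum is taken over a set that is nonempty for clones on a finite set with a
  near-unanimity operation, by the Baker-Pixley theorem; otherwise the value is unspecified.
\<close>

definition clone_lambda :: "'a set \<Rightarrow> 'a operation set \<Rightarrow> nat" where
  "clone_lambda A C = (LEAST m. 1 \<le> m \<and> C = Clo A (ary_part C m))"

definition cons_nu_clones :: "nat \<Rightarrow> nat \<Rightarrow> nat operation set set" where
  "cons_nu_clones d n =
     {C. is_clone {0..<n} C \<and>
         (\<exists>g. (d + 1, g) \<in> C \<and> near_unanimity {0..<n} d g \<and> conservative {0..<n} (d + 1) g)}"

text \<open>
  For \<open>d \<ge> 2\<close> and \<open>n \<ge> 2\<close> the set of clones is finite (again by Baker-Pixley) and nonempty, so
  that the maximum exists.
\<close>

definition clone_gamma :: "nat \<Rightarrow> nat \<Rightarrow> nat" where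
  "clone_gamma d n = Max (clone_lambda {0..<n} ` cons_nu_clones d n)"

lemma tuples_map:
  "xs \<in> tuples A k \<Longrightarrow> (\<And>g. g \<in> set gs \<Longrightarrow> g \<in> tuples A k \<rightarrow>\<^sub>E A) \<Longrightarrow>
    map (\<lambda>g. g xs) gs \<in> tuples A (length gs)"
  by (auto simp: tuples_def PiE_iff)

lemma is_clone_all_ops: "is_clone A (all_ops A)"
proof -
  have "proj_op A m i \<in> all_ops A" if "i < m" for m i
    using that by (auto simp: proj_op_def all_ops_def tuples_def)
  moreover have "comp_op A k f gs \<in> all_ops A"
    if f: "(m, f) \<in> all_ops A" and len: "length gs = m"
      and gs: "\<forall>g \<in> set gs. (k, g) \<in> all_ops A" for m k f gs
  proof -
    have "f (map (\<lambda>g. g xs) gs) \<in> A" if "xs \<in> tuples A k" for xs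
      using f len tuples_map[OF that, of gs] gs by (auto simp: all_ops_def)
    moreover have "1 \<le> k"
      using f len gs by (cases gs) (auto simp: all_ops_def)
    ultimately show ?thesis
      by (auto simp: comp_op_def all_ops_def)
  qed
  ultimately show ?thesis
    unfolding is_clone_def by blast
qed

lemma is_clone_Clo:
  assumes "F \<subseteq> all_ops A"
  shows "is_clone A (Clo A F)"
proof -
  have sub: "Clo A F \<subseteq> all_ops A"
    using assms is_clone_all_ops unfolding Clo_def by blast
  have pr: "\<forall>m i. i < m \<longrightarrow> proj_op A m i \<in> Clo A F"
    unfolding Clo_def is_clone_def by blast
  have "comp_op A k f gs \<in> C"
    if "(m, f) \<in> Clo A F" "length gs = m" "\<forall>g \<in> set gs. (k, g) \<in> Clo A F"
      "is_clone A C" "F \<subseteq> C" for m k f gs C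
  proof -
    have "(m, f) \<in> C" "\<forall>g \<in> set gs. (k, g) \<in> C"
      using that unfolding Clo_def by blast+
    then show ?thesis
      using that(2,4) unfolding is_clone_def by blast
  qed
  then have "\<forall>m k f gs. (m, f) \<in> Clo A F \<and> length gs = m \<and> (\<forall>g \<in> set gs. (k, g) \<in> Clo A F)
      \<longrightarrow> comp_op A k f gs \<in> Clo A F"
    by (auto simp: Clo_def)
  with sub pr show ?thesis
    unfolding is_clone_def by blast
qed

lemma Clo_least: "is_clone A C \<Longrightarrow> F \<subseteq> C \<Longrightarrow> Clo A F \<subseteq> C"
  unfolding Clo_def by blast

lemma subset_Clo: "F \<subseteq> Clo A F"
  unfolding Clo_def by blast

end

theory Submission
  imports Defs
begin

text \<open>
  Upper bound. Let \<open>C\<close> be a clone on an \<open>n\<close>-element set \<open>A\<close> with a conservative majority operation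
  \<open>g\<close>, and let \<open>D\<close> be generated by the \<open>2n\<close>-ary operations of \<open>C\<close>; then \<open>g \<in> D\<close>. By the Baker-Pixley
  argument (\<open>Baker_Pixley\<close>) an operation \<open>f \<in> C\<close> lies in \<open>D\<close> as soon as it can be interpolated in \<open>D\<close>
  on any two rows \<open>x, y\<close>. Among the sets of columns \<open>(x\<^sub>i, y\<^sub>i)\<close> that generate \<open>(f x, f y)\<close> under \<open>C\<close>
  take one of least cardinality, say \<open>T\<close>. No element of \<open>T\<close> is generated by the others. View \<open>T\<close>
  as a bipartite graph between two copies of \<open>A\<close>. If a vertex \<open>p\<close> had three neighbours
  \<open>q, r, s\<close>, each with a further edge, then \<open>g(q, r, s)\<close> would be one of them, say \<open>q\<close>, and with
  \<open>(p', q) \<in> T\<close> the edge \<open>(p, q) = g((p', q), (p, r), (p, s))\<close> would be redundant. So every vertex has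
  at most two neighbours of degree at least two. The edges with both ends of degree at least two are
  then no more than the vertices of degree at least two, and each other edge can be charged to an end
  of degree one. Hence \<open>T\<close> has at most \<open>2n\<close> elements, and some \<open>2n\<close>-ary operation of \<open>C\<close> does the
  interpolation (\<open>generated_by_twice_card_ary\<close>).

  Lower bound. The counting is sharp for a hexagon with a pendant edge at every remaining vertex. On
  the chain \<open>0 < \<dots> < m\<close> with \<open>m = n - 1\<close> take the hexagon on \<open>0, 1, m\<close> (in both copies) and the pendant
  edges \<open>(c, 1)\<close> and \<open>(0, c)\<close> for \<open>2 \<le> c < m\<close>; call this set \<open>T\<close>. It lies in the relation
  \<open>R = {(p, q). (p \<le> 1 \<or> q \<le> 1) \<and> (1 \<le> p \<or> 1 \<le> q)}\<close>. A map \<open>R \<rightarrow> R\<close> fixing every \<open>t \<in> T\<close> splits \<open>R\<close>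
  into fibres; let \<open>S t\<close> be \<open>R\<close> without the fibre of \<open>t\<close>, and let \<open>C\<close> consist of the operations
  preserving all \<open>S t\<close>. These relations are definable by clauses in order intervals and by unary
  conditions, so the median of the chain, a conservative majority operation, belongs to \<open>C\<close>
  (\<open>preserves_med_op_S\<close>). Fewer than \<open>2n\<close> elements of \<open>R\<close> miss some fibre and so lie in some \<open>S t\<close>;
  therefore all operations of \<open>C\<close> of arity less than \<open>2n\<close> preserve \<open>R\<close>. But the operation with value
  \<open>2\<close> on the two rows of a list of all elements of \<open>T\<close>, and value \<open>1\<close> elsewhere, belongs to \<open>C\<close>
  (\<open>two_on_in_C\<close>) and maps \<open>T\<close> to \<open>(2, 2) \<notin> R\<close>.
\<close>

section \<open>Invariant binary relations\<close>

text \<open>The columns of a \<open>2 \<times> k\<close> matrix are given as a list of \<open>k\<close> pairs.\<close>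

definition preserves :: "'a operation \<Rightarrow> ('a \<times> 'a) set \<Rightarrow> bool" where
  "preserves p \<rho> \<longleftrightarrow>
     (\<forall>ps. length ps = fst p \<and> set ps \<subseteq> \<rho> \<longrightarrow> (snd p (map fst ps), snd p (map snd ps)) \<in> \<rho>)"

lemma preservesD:
  "preserves (k, h) \<rho> \<Longrightarrow> length ps = k \<Longrightarrow> set ps \<subseteq> \<rho> \<Longrightarrow> (h (map fst ps), h (map snd ps)) \<in> \<rho>"
  by (simp add: preserves_def)

text \<open>The polymorphisms on \<open>A\<close> of a set of binary relations.\<close>

definition Pol :: "'a set \<Rightarrow> ('a \<times> 'a) set set \<Rightarrow> 'a operation set" where
  "Pol A \<Gamma> = {p \<in> all_ops A. \<forall>\<rho>\<in>\<Gamma>. preserves p \<rho>}"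

lemma tuples_fst_snd:
  assumes "set ps \<subseteq> A \<times> A"
  shows "map fst ps \<in> tuples A (length ps)" "map snd ps \<in> tuples A (length ps)"
  using assms by (auto simp: tuples_def)

lemma proj_op_apply: "xs \<in> tuples A k \<Longrightarrow> snd (proj_op A k i) xs = xs ! i"
  by (simp add: proj_op_def)

lemma comp_op_apply:
  "xs \<in> tuples A k \<Longrightarrow> snd (comp_op A k f gs) xs = f (map (\<lambda>g. g xs) gs)"
  by (simp add: comp_op_def)

lemma fst_comp_op [simp]: "fst (comp_op A k f gs) = k"
  by (simp add: comp_op_def)

lemma comp_op_pair: "(k, snd (comp_op A k f gs)) = comp_op A k f gs"
  by (simp add: comp_op_def)

lemma is_cloneD:
  assumes "is_clone A C"
  shows is_clone_ops: "C \<subseteq> all_ops A"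
    and is_clone_proj: "i < m \<Longrightarrow> proj_op A m i \<in> C"
    and is_clone_comp: "(m, f) \<in> C \<Longrightarrow> length gs = m \<Longrightarrow> (\<And>g. g \<in> set gs \<Longrightarrow> (k, g) \<in> C) \<Longrightarrow>
      comp_op A k f gs \<in> C"
  using assms unfolding is_clone_def by blast+

lemma preserves_proj_op:
  assumes "\<rho> \<subseteq> A \<times> A" "i < m"
  shows "preserves (proj_op A m i) \<rho>"
proof -
  have "(snd (proj_op A m i) (map fst ps), snd (proj_op A m i) (map snd ps)) \<in> \<rho>"
    if ps: "length ps = m" "set ps \<subseteq> \<rho>" for ps
  proof -
    have "map fst ps \<in> tuples A m" "map snd ps \<in> tuples A m"
      using tuples_fst_snd[of ps A] ps assms(1) by auto
    then show ?thesis
      using ps assms(2) by (auto simp: proj_op_apply)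
  qed
  then show ?thesis
    by (auto simp: preserves_def proj_op_def)
qed

lemma preserves_comp_op:
  assumes "\<rho> \<subseteq> A \<times> A" and f: "preserves (m, f) \<rho>" and len: "length gs = m"
    and gs: "\<And>g. g \<in> set gs \<Longrightarrow> preserves (k, g) \<rho>"
  shows "preserves (comp_op A k f gs) \<rho>"
proof -
  have "(snd (comp_op A k f gs) (map fst ps), snd (comp_op A k f gs) (map snd ps)) \<in> \<rho>"
    if ps: "length ps = k" "set ps \<subseteq> \<rho>" for ps
  proof -
    have *: "map fst ps \<in> tuples A k" "map snd ps \<in> tuples A k"
      using tuples_fst_snd[of ps A] ps assms(1) by auto
    let ?qs = "map (\<lambda>g. (g (map fst ps), g (map snd ps))) gs"
    have "set ?qs \<subseteq> \<rho>"
      using preservesD[OF gs ps] by auto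
    from preservesD[OF f _ this] len show ?thesis
      by (simp add: comp_op_apply[OF *(1)] comp_op_apply[OF *(2)] comp_def)
  qed
  then show ?thesis
    by (auto simp: preserves_def)
qed

lemma is_clone_Pol:
  assumes "\<And>\<rho>. \<rho> \<in> \<Gamma> \<Longrightarrow> \<rho> \<subseteq> A \<times> A"
  shows "is_clone A (Pol A \<Gamma>)"
proof -
  note ops = is_cloneD[OF is_clone_all_ops[of A]]
  have "comp_op A k f gs \<in> Pol A \<Gamma>"
    if "(m, f) \<in> Pol A \<Gamma>" "length gs = m" "\<forall>g \<in> set gs. (k, g) \<in> Pol A \<Gamma>" for m k f gs
    using that ops(3)[of m f gs k] assms preserves_comp_op[of _ A m f gs k]
    unfolding Pol_def by blast
  moreover have "proj_op A m i \<in> Pol A \<Gamma>" if "i < m" for m i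
    using ops(2)[OF that] preserves_proj_op[OF assms that] by (simp add: Pol_def)
  ultimately show ?thesis
    unfolding is_clone_def by (auto simp: Pol_def)
qed

text \<open>
  The subalgebra of \<open>A \<times> A\<close> generated by \<open>T\<close> under \<open>C\<close>, that is, the least invariant relation
  containing \<open>T\<close>, for \<open>T \<subseteq> A \<times> A\<close>.
\<close>

definition gen :: "'a set \<Rightarrow> 'a operation set \<Rightarrow> ('a \<times> 'a) set \<Rightarrow> ('a \<times> 'a) set" where
  "gen A C T = \<Inter> {\<rho>. T \<subseteq> \<rho> \<and> \<rho> \<subseteq> A \<times> A \<and> (\<forall>p\<in>C. preserves p \<rho>)}"

lemma gen_least:
  "T \<subseteq> \<rho> \<Longrightarrow> \<rho> \<subseteq> A \<times> A \<Longrightarrow> (\<And>p. p \<in> C \<Longrightarrow> preserves p \<rho>) \<Longrightarrow> gen A C T \<subseteq> \<rho>"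
  unfolding gen_def by blast

lemma subset_gen: "T \<subseteq> gen A C T"
  unfolding gen_def by blast

lemma preserves_full: "p \<in> all_ops A \<Longrightarrow> preserves p (A \<times> A)"
  using tuples_fst_snd[of _ A] by (fastforce simp: preserves_def all_ops_def)

lemma preserves_gen: "p \<in> C \<Longrightarrow> preserves p (gen A C T)"
  unfolding preserves_def gen_def by blast

lemma gen_subset: "C \<subseteq> all_ops A \<Longrightarrow> T \<subseteq> A \<times> A \<Longrightarrow> gen A C T \<subseteq> A \<times> A"
  by (rule gen_least) (auto intro: preserves_full)

lemma gen_empty: "C \<subseteq> all_ops A \<Longrightarrow> gen A C {} = {}"
  using gen_least[of "{}" "{}" A C] by (force simp: preserves_def all_ops_def)

lemma gen_redundant:
  assumes "C \<subseteq> all_ops A" "T \<subseteq> A \<times> A" "t \<in> gen A C (T - {t})"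
  shows "gen A C T \<subseteq> gen A C (T - {t})"
proof (rule gen_least[OF _ _ preserves_gen])
  show "T \<subseteq> gen A C (T - {t})"
    using assms(3) subset_gen[of "T - {t}" A C] by blast
  show "gen A C (T - {t}) \<subseteq> A \<times> A"
    using assms(1,2) by (intro gen_subset) auto
qed

text \<open>
  Each generated pair is the value of one operation on a list of the generators. The list may repeat
  entries, so every arity that is at least the number of generators will do.
\<close>

lemma gen_term:
  assumes C: "is_clone A C" and ts: "set ts \<subseteq> A \<times> A" and r: "r \<in> gen A C (set ts)"
  obtains h where "(length ts, h) \<in> C" "r = (h (map fst ts), h (map snd ts))"
proof -
  let ?k = "length ts"
  let ?\<rho> = "{(h (map fst ts), h (map snd ts)) | h. (?k, h) \<in> C}"
  note tup = tuples_fst_snd[OF ts]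
  have "set ts \<subseteq> ?\<rho>"
  proof
    fix t assume "t \<in> set ts"
    then obtain i where i: "i < ?k" "t = ts ! i"
      by (auto simp: in_set_conv_nth)
    have "(?k, snd (proj_op A ?k i)) \<in> C"
      using is_clone_proj[OF C i(1)] by (simp add: proj_op_def)
    then show "t \<in> ?\<rho>"
      using i proj_op_apply[OF tup(1), of i] proj_op_apply[OF tup(2), of i]
      by (intro CollectI exI[of _ "snd (proj_op A ?k i)"]) simp
  qed
  moreover have "?\<rho> \<subseteq> A \<times> A"
    using is_clone_ops[OF C] tup by (fastforce simp: all_ops_def)
  moreover have "preserves p ?\<rho>" if p: "p \<in> C" for p
    unfolding preserves_def
  proof (intro allI impI, elim conjE)
    fix ps assume len: "length ps = fst p" and ps: "set ps \<subseteq> ?\<rho>"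
    have "\<forall>q\<in>set ps. \<exists>h. (?k, h) \<in> C \<and> q = (h (map fst ts), h (map snd ts))"
      using ps by blast
    then obtain H where H: "\<And>q. q \<in> set ps \<Longrightarrow> (?k, H q) \<in> C"
      "\<And>q. q \<in> set ps \<Longrightarrow> q = (H q (map fst ts), H q (map snd ts))"
      by metis
    let ?h = "comp_op A ?k (snd p) (map H ps)"
    have "?h \<in> C"
      using p len H(1) by (intro is_clone_comp[OF C, of "fst p"]) auto
    then have "(?k, snd ?h) \<in> C"
      by (simp only: comp_op_pair)
    moreover have "map (\<lambda>h. h (map fst ts)) (map H ps) = map fst ps"
      unfolding map_map comp_def by (rule map_cong[OF refl]) (metis H(2) fst_conv)
    then have "snd ?h (map fst ts) = snd p (map fst ps)"
      by (simp only: comp_op_apply[OF tup(1)])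
    moreover have "map (\<lambda>h. h (map snd ts)) (map H ps) = map snd ps"
      unfolding map_map comp_def by (rule map_cong[OF refl]) (metis H(2) snd_conv)
    then have "snd ?h (map snd ts) = snd p (map snd ps)"
      by (simp only: comp_op_apply[OF tup(2)])
    ultimately show "(snd p (map fst ps), snd p (map snd ps)) \<in> ?\<rho>"
      by (intro CollectI exI[of _ "snd ?h"]) simp
  qed
  ultimately have "gen A C (set ts) \<subseteq> ?\<rho>"
    by (rule gen_least)
  then show thesis
    using r that by blast
qed

section \<open>The Baker-Pixley interpolation argument\<close>

lemma finite_tuples: "finite A \<Longrightarrow> finite (tuples A m)"
  using finite_lists_length_eq[of A m] by (simp add: tuples_def conj_commute)

lemma majority_eqs:
  assumes "near_unanimity A 2 g" "x \<in> A" "y \<in> A"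
  shows "g [y, x, x] = x" "g [x, y, x] = x" "g [x, x, y] = x"
proof -
  have *: "g ((replicate 3 x)[i := y]) = x" if "i < 3" for i
    using assms that by (simp add: near_unanimity_def numeral_eq_Suc)
  show "g [y, x, x] = x" "g [x, y, x] = x" "g [x, x, y] = x"
    using *[of 0] *[of 1] *[of 2] by (simp_all add: numeral_eq_Suc)
qed

text \<open>
  Interpolation on larger sets \<open>X\<close> reduces to smaller ones: interpolants on \<open>X\<close> without one of three
  chosen points are combined by the majority operation, since at each point of \<open>X\<close> at most one of
  them may be wrong.
\<close>

lemma Baker_Pixley_interpolation:
  assumes D: "is_clone A D" and g: "(3, g) \<in> D" "near_unanimity A 2 g"
    and f: "f \<in> tuples A k \<rightarrow>\<^sub>E A"
    and two: "\<And>x y. x \<in> tuples A k \<Longrightarrow> y \<in> tuples A k \<Longrightarrow> \<exists>h. (k, h) \<in> D \<and> h x = f x \<and> h y = f y"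
    and X: "finite X" "X \<subseteq> tuples A k" "X \<noteq> {}"
  shows "\<exists>h. (k, h) \<in> D \<and> (\<forall>x\<in>X. h x = f x)"
  using X
proof (induction "card X" arbitrary: X rule: less_induct)
  case less
  show ?case
  proof (cases "\<exists>x y. X \<subseteq> {x, y}")
    case True
    then obtain x y where xy: "X \<subseteq> {x, y}"
      by blast
    have "\<exists>x\<in>X. \<exists>y\<in>X. X \<subseteq> {x, y}"
    proof (cases "x \<in> X")
      case True
      then show ?thesis
        using xy by (cases "y \<in> X") auto
    next
      case False
      then show ?thesis
        using xy less.prems(3) by auto
    qed
    then obtain x y where "x \<in> tuples A k" "y \<in> tuples A k" "X \<subseteq> {x, y}"
      using less.prems(2) by blast
    then show ?thesis
      using two[of x y] by blast
  next
    case False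
    obtain x where x: "x \<in> X" using less.prems(3) by blast
    obtain y where y: "y \<in> X" "y \<noteq> x" using False by blast
    obtain z where z: "z \<in> X" "z \<noteq> x" "z \<noteq> y" using False by blast
    have "\<exists>h. (k, h) \<in> D \<and> (\<forall>x\<in>X - {u}. h x = f x)" if "u \<in> X" for u
    proof (rule less.hyps)
      show "card (X - {u}) < card X"
        using less.prems(1) that by (rule card_Diff1_less)
      show "X - {u} \<noteq> {}"
        using x y z that by blast
    qed (use less.prems in auto)
    then obtain hx hy hz where
      h: "(k, hx) \<in> D" "(k, hy) \<in> D" "(k, hz) \<in> D" "\<And>u. u \<in> X - {x} \<Longrightarrow> hx u = f u"
        "\<And>u. u \<in> X - {y} \<Longrightarrow> hy u = f u" "\<And>u. u \<in> X - {z} \<Longrightarrow> hz u = f u"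
      using x y(1) z(1) by meson
    let ?h = "comp_op A k g [hx, hy, hz]"
    have "?h \<in> D"
      using h g by (intro is_clone_comp[OF D, of 3]) auto
    then have "(k, snd ?h) \<in> D"
      by (simp only: comp_op_pair)
    moreover have "snd ?h u = f u" if u: "u \<in> X" for u
    proof -
      have ut: "u \<in> tuples A k"
        using u less.prems(2) by blast
      have "hx u \<in> A" "hy u \<in> A" "hz u \<in> A" "f u \<in> A"
        using h(1-3) is_clone_ops[OF D] ut f by (auto simp: all_ops_def)
      moreover have "u \<noteq> x \<and> u \<noteq> y \<or> u \<noteq> x \<and> u \<noteq> z \<or> u \<noteq> y \<and> u \<noteq> z"
        using y z by blast
      ultimately show ?thesis
        using h(4-6)[of u] u majority_eqs[OF g(2)] by (auto simp: comp_op_apply[OF ut])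
    qed
    ultimately show ?thesis
      by blast
  qed
qed

lemma Baker_Pixley:
  assumes A: "finite A" "A \<noteq> {}" and D: "is_clone A D" and g: "(3, g) \<in> D" "near_unanimity A 2 g"
    and f: "(k, f) \<in> all_ops A"
    and two: "\<And>x y. x \<in> tuples A k \<Longrightarrow> y \<in> tuples A k \<Longrightarrow> \<exists>h. (k, h) \<in> D \<and> h x = f x \<and> h y = f y"
  shows "(k, f) \<in> D"
proof -
  have f': "f \<in> tuples A k \<rightarrow>\<^sub>E A"
    using f by (simp add: all_ops_def)
  obtain a where "a \<in> A" using A(2) by blast
  then have "replicate k a \<in> tuples A k"
    by (auto simp: tuples_def)
  then obtain h where h: "(k, h) \<in> D" "\<forall>x\<in>tuples A k. h x = f x"
    using Baker_Pixley_interpolation[OF D g f' two finite_tuples[OF A(1), of k]] by blast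
  have "h \<in> tuples A k \<rightarrow>\<^sub>E A"
    using h(1) is_clone_ops[OF D] by (auto simp: all_ops_def)
  then have "h = f"
    using f' h(2) by (auto intro: PiE_ext)
  then show ?thesis
    using h(1) by simp
qed

section \<open>Independent sets of pairs under a conservative majority operation\<close>

text \<open>
  The hypothesis on \<open>T\<close> says that \<open>g\<close> never yields an element of \<open>T\<close> from three others. It is
  invariant under exchanging the two coordinates.
\<close>

lemma at_most_two_branching_neighbours:
  fixes T :: "('a \<times> 'a) set"
  assumes g: "near_unanimity A 2 g" "conservative A 3 g" and T: "T \<subseteq> A \<times> A"
    and indep: "\<And>s t u. \<lbrakk>s \<in> T; t \<in> T; u \<in> T;
        (g [fst s, fst t, fst u], g [snd s, snd t, snd u]) \<in> T\<rbrakk> \<Longrightarrow>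
        (g [fst s, fst t, fst u], g [snd s, snd t, snd u]) \<in> {s, t, u}"
  shows "card {q. (p, q) \<in> T \<and> (\<exists>p'. p' \<noteq> p \<and> (p', q) \<in> T)} \<le> 2"
proof (rule ccontr)
  let ?N = "{q. (p, q) \<in> T \<and> (\<exists>p'. p' \<noteq> p \<and> (p', q) \<in> T)}"
  assume "\<not> card ?N \<le> 2"
  then have "3 \<le> card ?N"
    by simp
  then obtain N where N: "N \<subseteq> ?N" "card N = 3"
    by (meson obtain_subset_with_card_n)
  then obtain q r s where qrs: "N = {q, r, s}" "q \<noteq> r" "r \<noteq> s" "q \<noteq> s"
    by (metis card_3_iff)
  then have e: "(p, q) \<in> T" "(p, r) \<in> T" "(p, s) \<in> T"
    using N by auto
  obtain q' r' s' where e': "(q', q) \<in> T" "(r', r) \<in> T" "(s', s) \<in> T"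
    "q' \<noteq> p" "r' \<noteq> p" "s' \<noteq> p"
    using N qrs(1) by auto
  have in_A: "p \<in> A" "q' \<in> A" "r' \<in> A" "s' \<in> A" "q \<in> A" "r \<in> A" "s \<in> A"
    using e e' T by auto
  have "[q, r, s] \<in> tuples A 3"
    using in_A by (simp add: tuples_def)
  then have "g [q, r, s] \<in> {q, r, s}"
    using g(2) unfolding conservative_def by fastforce
  \<comment> \<open>The edge at the chosen neighbour is replaced by the other edge there; the majority law
    restores the left end \<open>p\<close>.\<close>
  then consider "g [q, r, s] = q" | "g [q, r, s] = r" | "g [q, r, s] = s"
    by blast
  then show False
  proof cases
    case 1
    then show False
      using indep[of "(q', q)" "(p, r)" "(p, s)"] e e' qrs majority_eqs[OF g(1)] in_A by auto
  next
    case 2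
    then show False
      using indep[of "(p, q)" "(r', r)" "(p, s)"] e e' qrs majority_eqs[OF g(1)] in_A by auto
  next
    case 3
    then show False
      using indep[of "(p, q)" "(p, r)" "(s', s)"] e e' qrs majority_eqs[OF g(1)] in_A by auto
  qed
qed

lemma card_le_sum_of_fibres:
  assumes "finite E" "finite L" "fst ` E \<subseteq> L" "\<And>p. p \<in> L \<Longrightarrow> card {q. (p, q) \<in> E} \<le> d"
  shows "card E \<le> d * card L"
proof -
  have "E = Sigma L (\<lambda>p. {q. (p, q) \<in> E})"
    using assms(3) by force
  moreover have "finite {q. (p, q) \<in> E}" for p
    by (rule finite_subset[of _ "snd ` E"]) (use assms(1) in force)+
  ultimately have "card E = (\<Sum>p\<in>L. card {q. (p, q) \<in> E})"
    using card_SigmaI[OF assms(2), of "\<lambda>p. {q. (p, q) \<in> E}"] by simp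
  also have "\<dots> \<le> (\<Sum>p\<in>L. d)"
    using assms(4) by (intro sum_mono)
  finally show ?thesis
    by (simp add: mult.commute)
qed

text \<open>
  Both copies of \<open>A\<close> contribute vertices, whence the factor \<open>2\<close>. The edges joining vertices of degree
  at least two number at most \<open>2 * card L2\<close> and at most \<open>2 * card R2\<close>, hence at most the mean of the two.
\<close>

lemma card_bipartite_le:
  fixes T :: "('a \<times> 'a) set"
  assumes A: "finite A" and T: "T \<subseteq> A \<times> A"
    and left: "\<And>p. card {q. (p, q) \<in> T \<and> (\<exists>p'. p' \<noteq> p \<and> (p', q) \<in> T)} \<le> 2"
    and right: "\<And>q. card {p. (p, q) \<in> T \<and> (\<exists>q'. q' \<noteq> q \<and> (p, q') \<in> T)} \<le> 2"
  shows "card T \<le> 2 * card A"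
proof -
  define L2 where "L2 = {p \<in> A. \<exists>q q'. q \<noteq> q' \<and> (p, q) \<in> T \<and> (p, q') \<in> T}"
  define R2 where "R2 = {q \<in> A. \<exists>p p'. p \<noteq> p' \<and> (p, q) \<in> T \<and> (p', q) \<in> T}"
  define K where "K = T \<inter> L2 \<times> R2"
  have fin: "finite T" "finite L2" "finite R2" "finite K"
    using finite_subset[OF T] A by (auto simp: L2_def R2_def K_def)
  have nb: "finite {q. (p, q) \<in> T \<and> P q}" "finite {q. (q, p) \<in> T \<and> P q}" for p P
    by (rule finite_subset[OF _ A]; use T in auto)+
  have "card K \<le> 2 * card L2"
  proof (rule card_le_sum_of_fibres)
    show "card {q. (p, q) \<in> K} \<le> 2" for p
      by (rule order_trans[OF card_mono[OF nb(1)] left[of p]])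
        (auto simp: K_def R2_def, metis)
  qed (use fin in \<open>auto simp: K_def\<close>)
  moreover have "card (K\<inverse>) \<le> 2 * card R2"
  proof (rule card_le_sum_of_fibres)
    show "card {p. (q, p) \<in> K\<inverse>} \<le> 2" for q
      by (rule order_trans[OF card_mono[OF nb(2)] right[of q]])
        (auto simp: K_def L2_def, metis)
  qed (use fin in \<open>auto simp: K_def\<close>)
  ultimately have core: "card K \<le> card L2 + card R2"
    by simp
  \<comment> \<open>Every other edge is the only edge at one of its ends.\<close>
  have "card (T \<inter> (A - L2) \<times> A) \<le> card (A - L2)"
  proof (rule card_inj_on_le[of fst])
    show "inj_on fst (T \<inter> (A - L2) \<times> A)"
      by (rule inj_onI) (clarsimp simp: L2_def, blast)
  qed (use A in auto)
  moreover have "card (T \<inter> A \<times> (A - R2)) \<le> card (A - R2)"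
  proof (rule card_inj_on_le[of snd])
    show "inj_on snd (T \<inter> A \<times> (A - R2))"
      by (rule inj_onI) (clarsimp simp: R2_def, blast)
  qed (use A in auto)
  moreover have "T = K \<union> (T \<inter> (A - L2) \<times> A) \<union> (T \<inter> A \<times> (A - R2))"
    using T unfolding K_def by blast
  then have "card T \<le> card K + card (T \<inter> (A - L2) \<times> A) + card (T \<inter> A \<times> (A - R2))"
    using card_Un_le[of "K \<union> (T \<inter> (A - L2) \<times> A)" "T \<inter> A \<times> (A - R2)"]
      card_Un_le[of K "T \<inter> (A - L2) \<times> A"] by simp
  moreover have "card L2 + card (A - L2) = card A" "card R2 + card (A - R2) = card A"
    using A card_Diff_subset[of L2 A] card_Diff_subset[of R2 A] card_mono[of A L2] card_mono[of A R2]
    by (auto simp: L2_def R2_def)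
  ultimately show ?thesis
    using core by linarith
qed

lemma card_irredundant_generators_le:
  assumes A: "finite A" and C: "C \<subseteq> all_ops A"
    and g: "(3, g) \<in> C" "near_unanimity A 2 g" "conservative A 3 g" and T: "T \<subseteq> A \<times> A"
    and irr: "\<And>t. t \<in> T \<Longrightarrow> t \<notin> gen A C (T - {t})"
  shows "card T \<le> 2 * card A"
proof -
  have indep: "(g [fst s, fst t, fst u], g [snd s, snd t, snd u]) \<in> {s, t, u}"
    if stu: "s \<in> T" "t \<in> T" "u \<in> T" and r: "(g [fst s, fst t, fst u], g [snd s, snd t, snd u]) \<in> T"
    for s t u
  proof (rule ccontr)
    let ?r = "(g [fst s, fst t, fst u], g [snd s, snd t, snd u])"
    assume "?r \<notin> {s, t, u}"
    then have "set [s, t, u] \<subseteq> gen A C (T - {?r})"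
      using stu subset_gen[of "T - {?r}" A C] by auto
    from preservesD[OF preserves_gen[OF g(1)] _ this] irr[OF r] show False
      by simp
  qed
  show ?thesis
  proof (rule card_bipartite_le[OF A T])
    show "card {q. (p, q) \<in> T \<and> (\<exists>p'. p' \<noteq> p \<and> (p', q) \<in> T)} \<le> 2" for p
      by (rule at_most_two_branching_neighbours[OF g(2,3) T indep])
    have "T\<inverse> \<subseteq> A \<times> A"
      using T by auto
    moreover have "(g [fst s, fst t, fst u], g [snd s, snd t, snd u]) \<in> {s, t, u}"
      if "s \<in> T\<inverse>" "t \<in> T\<inverse>" "u \<in> T\<inverse>" "(g [fst s, fst t, fst u], g [snd s, snd t, snd u]) \<in> T\<inverse>"
      for s t u
      using indep[of "prod.swap s" "prod.swap t" "prod.swap u"] that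
      by (cases s; cases t; cases u) auto
    ultimately have "card {p. (q, p) \<in> T\<inverse> \<and> (\<exists>q'. q' \<noteq> q \<and> (q', p) \<in> T\<inverse>)} \<le> 2" for q
      by (rule at_most_two_branching_neighbours[OF g(2,3)])
    then show "card {p. (p, q) \<in> T \<and> (\<exists>q'. q' \<noteq> q \<and> (p, q') \<in> T)} \<le> 2" for q
      by simp
  qed
qed

section \<open>Generation by the operations of arity twice the size of the carrier\<close>

text \<open>Rearranging, identifying and adding arguments stays within the clone.\<close>

lemma comp_op_projections:
  assumes D: "is_clone A D" and h: "(N, h) \<in> D" and "length is = N" "set is \<subseteq> {..<k}"
  obtains h' where "(k, h') \<in> D" "\<And>x. x \<in> tuples A k \<Longrightarrow> h' x = h (map ((!) x) is)"
proof -
  let ?h = "comp_op A k h (map (\<lambda>i. snd (proj_op A k i)) is)"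
  have "(k, snd (proj_op A k i)) \<in> D" if "i < k" for i
    using is_clone_proj[OF D that] by (simp add: proj_op_def)
  then have "?h \<in> D"
    using assms by (intro is_clone_comp[OF D h]) auto
  then have "(k, snd ?h) \<in> D"
    by (simp only: comp_op_pair)
  moreover have "snd ?h x = h (map ((!) x) is)" if "x \<in> tuples A k" for x
    using that by (simp add: comp_op_apply proj_op_apply comp_def)
  ultimately show thesis
    using that by blast
qed

lemma lower_arity_in_Clo:
  assumes C: "is_clone A C" and f: "(k, f) \<in> C" and "k \<le> N"
  shows "(k, f) \<in> Clo A (ary_part C N)"
proof -
  let ?D = "Clo A (ary_part C N)"
  have k: "1 \<le> k" "f \<in> tuples A k \<rightarrow>\<^sub>E A"
    using is_clone_ops[OF C] f by (auto simp: all_ops_def)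
  have "set [0..<k] \<subseteq> {..<N}"
    using assms(3) by auto
  then obtain h where h: "(N, h) \<in> C" "\<And>x. x \<in> tuples A N \<Longrightarrow> h x = f (map ((!) x) [0..<k])"
    using comp_op_projections[OF C f, of "[0..<k]" N] by auto
  have D: "is_clone A ?D"
    using is_clone_ops[OF C] by (intro is_clone_Clo) (auto simp: ary_part_def)
  have "(N, h) \<in> ?D"
    using h(1) subset_Clo[of "ary_part C N" A] by (auto simp: ary_part_def)
  \<comment> \<open>The dummy arguments are filled with the first one.\<close>
  moreover let ?is = "[0..<k] @ replicate (N - k) 0"
  have "length ?is = N" "set ?is \<subseteq> {..<k}"
    using assms(3) k(1) by auto
  ultimately obtain h' where h': "(k, h') \<in> ?D" "\<And>x. x \<in> tuples A k \<Longrightarrow> h' x = h (map ((!) x) ?is)"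
    using comp_op_projections[OF D] by blast
  have "h' x = f x" if x: "x \<in> tuples A k" for x
  proof -
    have len: "length x = k" "set x \<subseteq> A"
      using x by (auto simp: tuples_def)
    have x0: "map ((!) x) ?is = x @ replicate (N - k) (x ! 0)"
      using len(1) map_nth[of x] by simp
    have "x ! 0 \<in> A"
      using len k(1) by (metis nth_mem subsetD less_le_trans zero_less_one)
    then have "x @ replicate (N - k) (x ! 0) \<in> tuples A N"
      using len assms(3) by (auto simp: tuples_def)
    moreover have "map ((!) (x @ replicate (N - k) (x ! 0))) [0..<k] = x"
      using len by (intro nth_equalityI) (auto simp: nth_append)
    ultimately show ?thesis
      using h'(2)[OF x] h(2) x0 by simp
  qed
  moreover have "h' \<in> tuples A k \<rightarrow>\<^sub>E A"
    using h'(1) is_clone_ops[OF D] by (auto simp: all_ops_def)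
  ultimately have "h' = f"
    using k(2) by (intro PiE_ext[of _ "tuples A k" "\<lambda>_. A"]) auto
  then show ?thesis
    using h'(1) by simp
qed

lemma exists_list_of_length:
  assumes "finite T" "T \<noteq> {}" "card T \<le> N"
  obtains ts where "set ts = T" "length ts = N"
proof -
  obtain us where us: "set us = T" "distinct us"
    using finite_distinct_list[OF assms(1)] by blast
  obtain t where "t \<in> T"
    using assms(2) by blast
  then have "set (us @ replicate (N - card T) t) = T"
    using us by auto
  moreover have "length (us @ replicate (N - card T) t) = N"
    using us assms(3) distinct_card[of us] by simp
  ultimately show thesis
    using that by blast
qed

theorem generated_by_twice_card_ary:
  assumes A: "finite A" "2 \<le> card A" and C: "is_clone A C"
    and g: "(3, g) \<in> C" "near_unanimity A 2 g" "conservative A 3 g"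
  shows "C = Clo A (ary_part C (2 * card A))"
proof
  let ?N = "2 * card A"
  let ?D = "Clo A (ary_part C ?N)"
  show "?D \<subseteq> C"
    by (rule Clo_least[OF C]) (auto simp: ary_part_def)
  have D: "is_clone A ?D"
    using is_clone_ops[OF C] by (intro is_clone_Clo) (auto simp: ary_part_def)
  have gD: "(3, g) \<in> ?D"
    using A(2) by (intro lower_arity_in_Clo[OF C g(1)]) simp
  have "(k, f) \<in> ?D" if f: "(k, f) \<in> C" for k f
  proof (rule Baker_Pixley[OF A(1) _ D gD g(2)])
    show "A \<noteq> {}"
      using A(2) by auto
    show "(k, f) \<in> all_ops A"
      using f is_clone_ops[OF C] by blast
    fix x y assume x: "x \<in> tuples A k" and y: "y \<in> tuples A k"
    define r where "r = (f x, f y)"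
    define T where "T = set (zip x y)"
    have len: "length x = k" "length y = k"
      using x y by (auto simp: tuples_def)
    have TA: "T \<subseteq> A \<times> A"
      using x y by (auto simp: T_def tuples_def dest: set_zip_leftD set_zip_rightD)
    have "r \<in> gen A C T"
      using preservesD[OF preserves_gen[OF f], of "zip x y" A T] subset_gen[of T A C] len
      by (simp add: r_def T_def)
    then obtain T0 where T0: "T0 \<subseteq> T" "r \<in> gen A C T0"
      and min: "\<And>U. U \<subseteq> T \<Longrightarrow> r \<in> gen A C U \<Longrightarrow> card T0 \<le> card U"
      using ex_has_least_nat[of "\<lambda>U. U \<subseteq> T \<and> r \<in> gen A C U" T card] by blast
    have T0A: "T0 \<subseteq> A \<times> A" "finite T0"
      using T0(1) TA finite_subset[of T0 T] by (auto simp: T_def)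
    have "t \<notin> gen A C (T0 - {t})" if t: "t \<in> T0" for t
    proof
      assume "t \<in> gen A C (T0 - {t})"
      then have "r \<in> gen A C (T0 - {t})"
        using gen_redundant[OF is_clone_ops[OF C] T0A(1)] T0(2) by blast
      then have "card T0 \<le> card (T0 - {t})"
        using T0(1) by (intro min) auto
      then show False
        using card_Diff1_less[OF T0A(2) t] by simp
    qed
    then have "card T0 \<le> ?N"
      by (rule card_irredundant_generators_le[OF A(1) is_clone_ops[OF C] g T0A(1)])
    moreover have "T0 \<noteq> {}"
      using T0(2) gen_empty[OF is_clone_ops[OF C]] by auto
    ultimately obtain ts where ts: "set ts = T0" "length ts = ?N"
      using exists_list_of_length[OF T0A(2)] by blast
    obtain h where h: "(?N, h) \<in> C" "r = (h (map fst ts), h (map snd ts))"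
      using gen_term[OF C, of ts r] T0(2) T0A(1) ts by auto
    have hD: "(?N, h) \<in> ?D"
      using h(1) subset_Clo[of "ary_part C ?N" A] by (auto simp: ary_part_def)
    have "\<forall>t\<in>set ts. \<exists>i<k. t = (x ! i, y ! i)"
    proof
      fix t assume "t \<in> set ts"
      then have "t \<in> set (zip x y)"
        using ts(1) T0(1) by (auto simp: T_def)
      then show "\<exists>i<k. t = (x ! i, y ! i)"
        using len by (auto simp: in_set_conv_nth)
    qed
    then obtain I where I: "\<And>t. t \<in> set ts \<Longrightarrow> I t < k \<and> t = (x ! I t, y ! I t)"
      by metis
    have "length (map I ts) = ?N" "set (map I ts) \<subseteq> {..<k}"
      using I ts(2) by auto
    then obtain h' where h': "(k, h') \<in> ?D" "\<And>u. u \<in> tuples A k \<Longrightarrow> h' u = h (map ((!) u) (map I ts))"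
      using comp_op_projections[OF D hD] by blast
    have "map ((!) x) (map I ts) = map fst ts"
      unfolding map_map comp_def by (rule map_cong[OF refl]) (metis I fst_conv)
    moreover have "map ((!) y) (map I ts) = map snd ts"
      unfolding map_map comp_def by (rule map_cong[OF refl]) (metis I snd_conv)
    ultimately have "h' x = f x" "h' y = f y"
      using h'(2)[OF x] h'(2)[OF y] h(2) by (simp_all only: r_def prod.inject)
    then show "\<exists>h. (k, h) \<in> ?D \<and> h x = f x \<and> h y = f y"
      using h'(1) by blast
  qed
  then show "C \<subseteq> ?D"
    by auto
qed

section \<open>A clone that needs operations of arity twice the size of the carrier\<close>

text \<open>The median of three elements of a chain, and the ternary operation that it induces on \<open>A\<close>.\<close>

definition med :: "'a::linorder \<Rightarrow> 'a \<Rightarrow> 'a \<Rightarrow> 'a" where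
  "med a b c = max (min a b) (min (max a b) c)"

definition med_op :: "'a::linorder set \<Rightarrow> 'a list \<Rightarrow> 'a" where
  "med_op A = restrict (\<lambda>xs. med (xs ! 0) (xs ! 1) (xs ! 2)) (tuples A 3)"

lemma med_in: "med a b c \<in> {a, b, c}"
  by (auto simp: med_def max_def min_def)

lemma med_majority [simp]: "med a a b = a" "med a b a = a" "med b a a = a"
  by (auto simp: med_def max_def min_def)

lemma tuples_3E:
  assumes "xs \<in> tuples A 3"
  obtains a b c where "xs = [a, b, c]" "a \<in> A" "b \<in> A" "c \<in> A"
  using assms by (auto simp: tuples_def numeral_eq_Suc length_Suc_conv)

lemma med_op_apply: "a \<in> A \<Longrightarrow> b \<in> A \<Longrightarrow> c \<in> A \<Longrightarrow> med_op A [a, b, c] = med a b c"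
  by (simp add: med_op_def tuples_def)

lemma conservative_med_op: "conservative A 3 (med_op A)"
  unfolding conservative_def
proof
  fix xs assume "xs \<in> tuples A 3"
  then obtain a b c where "xs = [a, b, c]" "a \<in> A" "b \<in> A" "c \<in> A"
    by (rule tuples_3E)
  then show "med_op A xs \<in> set xs"
    using med_in[of a b c] by (simp add: med_op_apply)
qed

lemma med_op_in_all_ops: "(3, med_op A) \<in> all_ops A"
proof -
  have "med_op A xs \<in> A" if xs: "xs \<in> tuples A 3" for xs
    using conservative_med_op[of A] xs by (auto simp: conservative_def tuples_def)
  then show ?thesis
    by (auto simp: all_ops_def med_op_def)
qed

lemma near_unanimity_med_op: "near_unanimity A 2 (med_op A)"
proof -
  have "med_op A ((replicate (2 + 1) x)[i := y]) = x" if "x \<in> A" "y \<in> A" "i < 2 + 1" for x y i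
  proof -
    have "i = 0 \<or> i = 1 \<or> i = 2"
      using that(3) by auto
    then show ?thesis
      using that(1,2) by (auto simp: numeral_eq_Suc med_op_apply)
  qed
  then show ?thesis
    using med_op_in_all_ops[of A] by (simp add: near_unanimity_def)
qed

lemma preserves_med_opI:
  assumes "\<rho> \<subseteq> A \<times> A"
    and "\<And>a b c a' b' c'. \<lbrakk>(a, a') \<in> \<rho>; (b, b') \<in> \<rho>; (c, c') \<in> \<rho>\<rbrakk> \<Longrightarrow> (med a b c, med a' b' c') \<in> \<rho>"
  shows "preserves (3, med_op A) \<rho>"
  unfolding preserves_def
proof (intro allI impI, elim conjE)
  fix ps assume "length ps = fst (3 :: nat, med_op A)" and ps: "set ps \<subseteq> \<rho>"
  then obtain p q r where "ps = [p, q, r]"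
    by (auto simp: numeral_eq_Suc length_Suc_conv)
  with ps have "p \<in> \<rho>" "q \<in> \<rho>" "r \<in> \<rho>" and [simp]: "ps = [p, q, r]"
    by auto
  moreover from this have "fst p \<in> A" "fst q \<in> A" "fst r \<in> A" "snd p \<in> A" "snd q \<in> A" "snd r \<in> A"
    using assms(1) by auto
  ultimately show "(snd (3 :: nat, med_op A) (map fst ps), snd (3 :: nat, med_op A) (map snd ps)) \<in> \<rho>"
    using assms(2)[of "fst p" "snd p" "fst q" "snd q" "fst r" "snd r"]
    by (simp add: med_op_apply)
qed

text \<open>
  \<open>P\<close> passes to the median when two of the three elements satisfy it. Of three pairs that satisfy
  \<open>P p \<or> Q q\<close>, at least two satisfy the same disjunct; so medians preserve such a clause.
\<close>

definition med_stable :: "('a::linorder \<Rightarrow> bool) \<Rightarrow> bool" where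
  "med_stable P \<longleftrightarrow> (\<forall>a b c. P a \<and> P b \<or> P a \<and> P c \<or> P b \<and> P c \<longrightarrow> P (med a b c))"

lemma med_stable_intervals [simp]:
  "med_stable (\<lambda>x. x \<le> i)" "med_stable (\<lambda>x. x < i)" "med_stable (\<lambda>x. i \<le> x)"
  by (auto simp: med_stable_def med_def max_def min_def)

lemma med_clause:
  assumes "med_stable P" "med_stable Q" "P a \<or> Q a'" "P b \<or> Q b'" "P c \<or> Q c'"
  shows "P (med a b c) \<or> Q (med a' b' c')"
  using assms unfolding med_stable_def by blast

text \<open>
  The carrier is \<open>{0..m}\<close>, so it has \<open>m + 1\<close> elements; the bound on \<open>m\<close> makes \<open>2\<close> different from the top
  element \<open>m\<close>.
\<close>

locale extremal_clone =
  fixes m :: nat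
  assumes m: "3 \<le> m"
begin

definition A :: "nat set" where "A = {0..m}"

text \<open>The relation that tells small arities from large ones: it omits \<open>(0, 0)\<close> and \<open>{2..m} \<times> {2..m}\<close>.\<close>

definition R :: "(nat \<times> nat) set" where
  "R = {(p, q). p \<in> A \<and> q \<in> A \<and> (p \<le> 1 \<or> q \<le> 1) \<and> (1 \<le> p \<or> 1 \<le> q)}"

text \<open>A hexagon: all pairs of distinct elements of \<open>{0, 1, m}\<close>.\<close>

definition core :: "(nat \<times> nat) set" where
  "core = {(0, 1), (1, 0), (0, m), (m, 0), (1, m), (m, 1)}"

text \<open>The generators: the hexagon, and a pendant edge at each of the other vertices on either side.\<close>

definition T :: "(nat \<times> nat) set" where
  "T = core \<union> {2..<m} \<times> {1} \<union> {0} \<times> {2..<m}"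

text \<open>
  A pair in \<open>R\<close> with an entry strictly between \<open>1\<close> and \<open>m\<close> has exactly one such entry; the pair is
  sent to the pendant edge at that vertex. All other pairs are fixed, in particular the hexagon and
  \<open>(1, 1)\<close>, which does not belong to \<open>T\<close>.
\<close>

definition lab :: "nat \<times> nat \<Rightarrow> nat \<times> nat" where
  "lab = (\<lambda>(p, q). if p \<in> {2..<m} then (p, 1) else if q \<in> {2..<m} then (0, q) else (p, q))"

text \<open>
  For \<open>t\<close> in the hexagon this is \<open>R\<close> without \<open>t\<close>; for a pendant edge \<open>t\<close> it is \<open>R\<close> without all pairs
  that contain its pendant vertex (on the side in question).
\<close>

definition S :: "nat \<times> nat \<Rightarrow> (nat \<times> nat) set" where
  "S t = {r \<in> R. lab r \<noteq> t}"

definition C :: "nat operation set" where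
  "C = Pol A (S ` T)"

lemma R_subset: "R \<subseteq> A \<times> A"
  by (auto simp: R_def)

lemma S_subset: "S t \<subseteq> R"
  by (auto simp: S_def)

lemma T_subset: "T \<subseteq> R"
  using m by (auto simp: T_def core_def R_def A_def)

lemma lab_T: "t \<in> T \<Longrightarrow> lab t = t"
  using m by (auto simp: T_def core_def lab_def)

lemma finite_T: "finite T"
  by (simp add: T_def core_def)

lemma card_T: "card T = 2 * (m + 1)"
proof -
  have "card (core \<union> {2..<m} \<times> {1}) = card core + card ({2..<m} \<times> {1 :: nat})"
    using m by (intro card_Un_disjoint) (auto simp: core_def)
  moreover have "card T = card (core \<union> {2..<m} \<times> {1}) + card ({0 :: nat} \<times> {2..<m})"
    unfolding T_def using m by (intro card_Un_disjoint) (auto simp: core_def)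
  moreover have "card core = 6"
    using m by (simp add: core_def)
  ultimately show ?thesis
    using m by (simp add: card_cartesian_product)
qed

lemma is_clone_C: "is_clone A C"
  unfolding C_def using S_subset R_subset by (intro is_clone_Pol) blast

text \<open>
  Within \<open>R\<close>, deleting an edge of the hexagon amounts to imposing one more clause, and deleting the
  pairs at a pendant vertex is a unary condition, which every conservative operation preserves.
\<close>

lemma preserves_med_op_S:
  assumes "t \<in> T"
  shows "preserves (3, med_op A) (S t)"
proof (rule preserves_med_opI)
  show "S t \<subseteq> A \<times> A"
    using S_subset R_subset by blast
  fix a b c a' b' c'
  assume *: "(a, a') \<in> S t" "(b, b') \<in> S t" "(c, c') \<in> S t"
  have **: "(a, a') \<in> R" "(b, b') \<in> R" "(c, c') \<in> R"
    using * by (auto simp: S_def)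
  let ?p = "med a b c" and ?q = "med a' b' c'"
  have "?p \<le> 1 \<or> ?q \<le> 1" "1 \<le> ?p \<or> 1 \<le> ?q"
    by (rule med_clause; use ** in \<open>simp add: R_def\<close>)+
  moreover have "{a, b, c} \<subseteq> A" "{a', b', c'} \<subseteq> A"
    using ** by (auto simp: R_def)
  then have "?p \<in> A" "?q \<in> A"
    using med_in[of a b c] med_in[of a' b' c'] by blast+
  ultimately have R: "(?p, ?q) \<in> R"
    by (simp add: R_def)
  have clause: "P ?p \<or> Q ?q"
    if "med_stable P" "med_stable Q" "\<And>p q. (p, q) \<in> S t \<Longrightarrow> P p \<or> Q q" for P Q
    by (rule med_clause[OF that(1,2)]) (rule that(3), rule *)+
  consider "t = (0, 1)" | "t = (1, 0)" | "t = (0, m)" | "t = (m, 0)" | "t = (1, m)" | "t = (m, 1)"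
    | d where "d \<in> {2..<m}" "t = (d, 1)" | d where "d \<in> {2..<m}" "t = (0, d)"
    using assms by (auto simp: T_def core_def)
  then have "lab (?p, ?q) \<noteq> t"
  proof cases
    case 1
    have "1 \<le> ?p \<or> 2 \<le> ?q"
      by (rule clause) (use 1 m in \<open>auto simp: S_def R_def lab_def split: if_splits\<close>)
    then show ?thesis
      using 1 m R by (auto simp: lab_def R_def)
  next
    case 2
    have "2 \<le> ?p \<or> 1 \<le> ?q"
      by (rule clause) (use 2 m in \<open>auto simp: S_def R_def lab_def split: if_splits\<close>)
    then show ?thesis
      using 2 m R by (auto simp: lab_def R_def)
  next
    case 3
    have "1 \<le> ?p \<or> ?q < m"
      by (rule clause) (use 3 m in \<open>auto simp: S_def R_def lab_def A_def split: if_splits\<close>)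
    then show ?thesis
      using 3 m R by (auto simp: lab_def R_def)
  next
    case 4
    have "?p < m \<or> 1 \<le> ?q"
      by (rule clause) (use 4 m in \<open>auto simp: S_def R_def lab_def A_def split: if_splits\<close>)
    then show ?thesis
      using 4 m R by (auto simp: lab_def R_def)
  next
    case 5
    have "?p < 1 \<or> ?q < m"
      by (rule clause[OF med_stable_intervals(2) med_stable_intervals(2)])
         (use 5 m in \<open>auto simp: S_def R_def lab_def A_def split: if_splits\<close>)
    then show ?thesis
      using 5 m R by (auto simp: lab_def R_def)
  next
    case 6
    have "?p < m \<or> ?q < 1"
      by (rule clause[OF med_stable_intervals(2) med_stable_intervals(2)])
         (use 6 m in \<open>auto simp: S_def R_def lab_def A_def split: if_splits\<close>)
    then show ?thesis
      using 6 m R by (auto simp: lab_def R_def)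
  next
    case (7 d)
    have "p \<noteq> d" if "(p, q) \<in> S t" for p q
      using that 7 by (auto simp: S_def R_def lab_def)
    then have "?p \<noteq> d"
      using * med_in[of a b c] by fastforce
    then show ?thesis
      using 7 by (auto simp: lab_def split: if_splits)
  next
    case (8 d)
    have "q \<noteq> d" if "(p, q) \<in> S t" for p q
      using that 8 by (auto simp: S_def R_def lab_def split: if_splits)
    then have "?q \<noteq> d"
      using * med_in[of a' b' c'] by fastforce
    then show ?thesis
      using 8 by (auto simp: lab_def split: if_splits)
  qed
  then show "(?p, ?q) \<in> S t"
    using R by (simp add: S_def)
qed

lemma med_op_in_C: "(3, med_op A) \<in> C"
  using med_op_in_all_ops preserves_med_op_S by (auto simp: C_def Pol_def)

lemma small_arity_preserves_R:
  assumes h: "(k, h) \<in> C" and k: "k < card T"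
  shows "preserves (k, h) R"
  unfolding preserves_def
proof (intro allI impI, elim conjE)
  fix ps assume len: "length ps = fst (k, h)" and ps: "set ps \<subseteq> R"
  have "card (lab ` set ps) < card T"
    using len k card_image_le[of "set ps" lab] card_length[of ps] by simp
  then obtain t where t: "t \<in> T" "t \<notin> lab ` set ps"
    by (meson List.finite_set card_mono finite_imageI not_le subsetI)
  then have "set ps \<subseteq> S t"
    using ps by (auto simp: S_def)
  moreover have "preserves (k, h) (S t)"
    using h t(1) by (auto simp: C_def Pol_def)
  ultimately show "(snd (k, h) (map fst ps), snd (k, h) (map snd ps)) \<in> R"
    using preservesD[of k h "S t" ps] len subsetD[OF S_subset[of t]] by simp
qed

text \<open>The operation with value \<open>2\<close> at the two given tuples and value \<open>1\<close> elsewhere.\<close>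

definition two_on :: "nat list \<Rightarrow> nat list \<Rightarrow> nat operation" where
  "two_on x y = (length x, restrict (\<lambda>u. if u = x \<or> u = y then 2 else 1) (tuples A (length x)))"

text \<open>
  The value pairs \<open>(1, 1)\<close>, \<open>(1, 2)\<close> and \<open>(2, 1)\<close> belong to every \<open>S t\<close>, except that \<open>S (2, 1)\<close> lacks
  \<open>(2, 1)\<close> and \<open>S (0, 2)\<close> lacks \<open>(1, 2)\<close>. In the exceptional cases the vertex \<open>2\<close> does not occur on the
  relevant side of \<open>S t\<close>, whereas the two rows with value \<open>2\<close> contain every element of the carrier.
  The value \<open>(2, 2)\<close> cannot occur: two equal rows would have the column \<open>(m, m) \<notin> R\<close>, the rows in
  their order have the column \<open>t\<close>, and in reverse order they have a column in the fibre of \<open>t\<close>.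
\<close>

lemma two_on_in_C:
  assumes ts: "set ts = T"
  shows "two_on (map fst ts) (map snd ts) \<in> C"
proof -
  let ?x = "map fst ts" and ?y = "map snd ts"
  have A12: "1 \<in> A" "2 \<in> A"
    using m by (auto simp: A_def)
  have "(0, 1) \<in> set ts"
    using ts by (simp add: T_def core_def)
  then have ops: "two_on ?x ?y \<in> all_ops A"
    using A12 by (cases ts) (auto simp: two_on_def all_ops_def)
  have mid: "c \<in> fst ` T" "c \<in> snd ` T" if "c \<in> A" for c
  proof -
    have "c = 0 \<or> c = 1 \<or> c = m \<or> c \<in> {2..<m}"
      using that by (auto simp: A_def)
    then have "(c, 1) \<in> T \<or> (c, 0) \<in> T" "(1, c) \<in> T \<or> (0, c) \<in> T"
      by (auto simp: T_def core_def)
    then show "c \<in> fst ` T" "c \<in> snd ` T"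
      by force+
  qed
  have "preserves (two_on ?x ?y) (S t)" if t: "t \<in> T" for t
    unfolding preserves_def
  proof (intro allI impI, elim conjE)
    fix ps assume len: "length ps = fst (two_on ?x ?y)" and ps: "set ps \<subseteq> S t"
    let ?u = "map fst ps" and ?v = "map snd ps"
    have len': "length ps = length ts"
      using len by (simp add: two_on_def)
    have psA: "set ps \<subseteq> A \<times> A"
      using ps S_subset[of t] R_subset by blast
    have val: "snd (two_on ?x ?y) ?u = (if ?u \<in> {?x, ?y} then 2 else 1)"
      "snd (two_on ?x ?y) ?v = (if ?v \<in> {?x, ?y} then 2 else 1)"
      using tuples_fst_snd[OF psA] len' by (simp_all add: two_on_def)
    \<comment> \<open>\<open>T\<close> covers all vertices on both sides.\<close>
    have full: "c \<in> set w" if w: "w \<in> {?x, ?y}" and c: "c \<in> A" for w c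
    proof -
      consider "w = ?x" | "w = ?y"
        using w by blast
      then have "set w = fst ` T \<or> set w = snd ` T"
        by cases (simp_all add: ts)
      then show ?thesis
        using mid[OF c] by blast
    qed
    have u: "t \<noteq> (2, 1)" if "?u \<in> {?x, ?y}"
    proof
      assume t: "t = (2, 1)"
      have "2 \<in> fst ` set ps"
        using full[OF that A12(2)] by simp
      then obtain q where "(2, q) \<in> set ps"
        by auto
      then show False
        using ps t m by (auto simp: S_def lab_def)
    qed
    have v: "t \<noteq> (0, 2)" if "?v \<in> {?x, ?y}"
    proof
      assume t: "t = (0, 2)"
      have "2 \<in> snd ` set ps"
        using full[OF that A12(2)] by simp
      then obtain p where "(p, 2) \<in> set ps"
        by auto
      then show False
        using ps t m by (auto simp: S_def lab_def R_def split: if_splits)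
    qed
    have "\<not> (?u \<in> {?x, ?y} \<and> ?v \<in> {?x, ?y})"
    proof
      assume uv: "?u \<in> {?x, ?y} \<and> ?v \<in> {?x, ?y}"
      have zip: "ps = zip ?u ?v"
        by (simp add: zip_map_fst_snd)
      show False
      proof (cases "?u = ?v")
        case True
        have "m \<in> set ?u"
          using full[of ?u m] uv by (simp add: A_def)
        then obtain q where "(m, q) \<in> set ps"
          by auto
        moreover have "p = q" if "(p, q) \<in> set ps" for p q
          using that True unfolding map_eq_conv by fastforce
        ultimately have "(m, m) \<in> R"
          using ps S_subset by blast
        then show False
          using m by (simp add: R_def)
      next
        case False
        then consider "?u = ?x" "?v = ?y" | "?u = ?y" "?v = ?x"
          using uv unfolding insert_iff empty_iff by metis
        then show False
        proof cases
          case 1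
          then have "ps = ts"
            using zip by (metis zip_map_fst_snd)
          then show False
            using ts t ps lab_T[OF t] by (auto simp: S_def)
        next
          case 2
          have "zip (map snd us) (map fst us) = map prod.swap us" for us :: "(nat \<times> nat) list"
            by (induction us) auto
          then have "ps = map prod.swap ts"
            using zip 2 by simp
          then have swap: "prod.swap ` T \<subseteq> S t"
            using ps ts by auto
          have "\<exists>r\<in>T. lab (prod.swap r) = t"
          proof -
            consider "t \<in> core" | c where "c \<in> {2..<m}" "t = (c, 1)" | c where "c \<in> {2..<m}" "t = (0, c)"
              using t by (auto simp: T_def)
            then show ?thesis
            proof cases
              case 1
              then have "prod.swap t \<in> T"
                by (auto simp: T_def core_def)
              then show ?thesis
                using lab_T[OF t] by (intro bexI[of _ "prod.swap t"]) auto
            next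
              case (2 c)
              then show ?thesis
                by (intro bexI[of _ "(0, c)"]) (auto simp: T_def lab_def)
            next
              case (3 c)
              then show ?thesis
                by (intro bexI[of _ "(c, 1)"]) (auto simp: T_def lab_def)
            qed
          qed
          then show False
            using swap by (auto simp: S_def)
        qed
      qed
    qed
    then consider "?u \<notin> {?x, ?y}" "?v \<notin> {?x, ?y}" | "?u \<in> {?x, ?y}" "?v \<notin> {?x, ?y}"
      | "?u \<notin> {?x, ?y}" "?v \<in> {?x, ?y}"
      by blast
    then show "(snd (two_on ?x ?y) ?u, snd (two_on ?x ?y) ?v) \<in> S t"
    proof cases
      case 1
      have "(1, 1) \<in> S t"
        using t m A12 by (auto simp: S_def R_def lab_def T_def core_def)
      then show ?thesis
        using 1 by (simp only: val if_False)
    next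
      case 2
      have "(2, 1) \<in> S t"
        using u[OF 2(1)] m A12 by (auto simp: S_def R_def lab_def)
      then show ?thesis
        using 2 by (simp only: val if_False if_True)
    next
      case 3
      have "(1, 2) \<in> S t"
        using v[OF 3(2)] m A12 by (auto simp: S_def R_def lab_def)
      then show ?thesis
        using 3 by (simp only: val if_False if_True)
    qed
  qed
  then show ?thesis
    using ops by (auto simp: C_def Pol_def)
qed

lemma not_generated_by_small_arity:
  assumes "k < card T"
  shows "C \<noteq> Clo A (ary_part C k)"
proof
  assume C: "C = Clo A (ary_part C k)"
  obtain ts where ts: "set ts = T"
    using finite_list[OF finite_T] by blast
  let ?F = "two_on (map fst ts) (map snd ts)"
  have "ary_part C k \<subseteq> Pol A {R}"
    using small_arity_preserves_R[OF _ assms] is_clone_ops[OF is_clone_C]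
    by (auto simp: ary_part_def Pol_def)
  then have "C \<subseteq> Pol A {R}"
    using C Clo_least[OF is_clone_Pol, of "{R}" A "ary_part C k"] R_subset by auto
  then have "preserves ?F R"
    using two_on_in_C[OF ts] by (auto simp: Pol_def)
  moreover have "length ts = fst ?F"
    by (simp add: two_on_def)
  ultimately have "(snd ?F (map fst ts), snd ?F (map snd ts)) \<in> R"
    using ts T_subset unfolding preserves_def by blast
  moreover have "map fst ts \<in> tuples A (length ts)" "map snd ts \<in> tuples A (length ts)"
    using tuples_fst_snd[of ts A] ts T_subset R_subset by auto
  ultimately show False
    by (simp add: two_on_def R_def)
qed

end

theorem corollary3p3:
  fixes n :: nat
  assumes "n \<ge> 4"
  shows "clone_gamma 2 n = 2 * n"
proof -
  let ?A = "{0..<n}"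
  obtain m where n: "n = Suc m"
    using assms by (cases n) auto
  interpret extremal_clone m
    using assms n by unfold_locales simp
  have A: "A = ?A"
    using n by (auto simp: A_def)
  have card_T': "card T = 2 * n"
    using card_T n by simp
  have gen: "C' = Clo ?A (ary_part C' (2 * n))" if C': "C' \<in> cons_nu_clones 2 n" for C'
  proof -
    obtain g where "is_clone ?A C'" "(3, g) \<in> C'" "near_unanimity ?A 2 g" "conservative ?A 3 g"
      using C' by (auto simp: cons_nu_clones_def numeral_eq_Suc)
    then show ?thesis
      using generated_by_twice_card_ary[of ?A C' g] assms by simp
  qed
  have upper: "clone_lambda ?A C' \<le> 2 * n" if "C' \<in> cons_nu_clones 2 n" for C'
    unfolding clone_lambda_def using gen[OF that] assms by (intro Least_le) simp
  have CC: "C \<in> cons_nu_clones 2 n"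
    using is_clone_C med_op_in_C near_unanimity_med_op[of ?A] conservative_med_op[of ?A]
    by (auto simp: cons_nu_clones_def A numeral_eq_Suc)
  have "1 \<le> clone_lambda ?A C \<and> C = Clo ?A (ary_part C (clone_lambda ?A C))"
    unfolding clone_lambda_def
    by (rule LeastI[of "\<lambda>k. 1 \<le> k \<and> C = Clo ?A (ary_part C k)" "2 * n"]) (use gen[OF CC] assms in simp)
  then have "2 * n \<le> clone_lambda ?A C"
    using not_generated_by_small_arity[of "clone_lambda ?A C"] card_T' A by (metis not_le)
  with upper[OF CC] have "clone_lambda ?A C = 2 * n"
    by simp
  then have "2 * n \<in> clone_lambda ?A ` cons_nu_clones 2 n"
    using CC by force
  moreover have "finite (clone_lambda ?A ` cons_nu_clones 2 n)"
    by (rule finite_subset[of _ "{..2 * n}"]) (use upper in auto)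
  ultimately show ?thesis
    unfolding clone_gamma_def using upper by (intro Max_eqI) auto
qed

end
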